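(* Let $K>0$, $\Delta>0$ and $\tau>0$ be fixed. For $r_e>\Delta$ put $\lambda_0=\frac{\pi}{2r_e}$ and let $R_0^{bd}=R_0^{bd}(r_e,\Delta)\in(0,\Delta)$ be a boundary dominated well block radius, i.e. a solution of $$\sin(\lambda_0R_0^{bd})-\sin(\lambda_0\Delta)+\frac{\lambda_0\Delta}{2}=\sin(\lambda_0R_0^{bd})\cdot\frac{1}{2K}\cdot\frac{e^{-\lambda_0^2\tau}-1}{\tau}.$$ Then $$\lim_{r_e\to\infty}R_0^{bd}(r_e,\Delta)=\frac{\Delta}{2}.$$
   Context: In the paper, $\lambda_0=\pi/(2r_e)$ corresponds to the first eigenfunction $\sin(\lambda_0x)$ on $(0,r_e)$ with zero Dirichlet condition at the well $x=0$ and zero Neumann condition at $x=r_e$. The boundary dominated well block radius is the number $R_0^{bd}<\Delta$, determined through the displayed transcendental equation, which yields Peaceman well-posedness for the boundary dominated regime. The value $R_0=\Delta/2$ is the one-dimensional steady-state Peaceman radius. *)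

theory Defs
  imports Complex_Main
begin

text \<open>
  Square root of the first eigenvalue of \<open>- d\<^sup>2/dx\<^sup>2\<close> on \<open>(0, re)\<close>
  with zero Dirichlet condition at the well \<open>x = 0\<close> and zero Neumann condition at \<open>x = re\<close>;
  the eigenfunction is \<open>\<lambda>x. sin (lambda0 re * x)\<close>.
\<close>

definition lambda0 :: "real \<Rightarrow> real" where
  "lambda0 re = pi / (2 * re)"

definition bd_well_block_radius :: "real \<Rightarrow> real \<Rightarrow> real \<Rightarrow> real \<Rightarrow> real \<Rightarrow> bool" where
  "bd_well_block_radius K \<tau> \<Delta> re R \<longleftrightarrow>
     0 < R \<and> R < \<Delta> \<and>
     sin (lambda0 re * R) - sin (lambda0 re * \<Delta>) + lambda0 re * \<Delta> / 2
       = sin (lambda0 re * R) * (1 / (2 * K)) * ((exp (- (lambda0 re)\<^sup>2 * \<tau>) - 1) / \<tau>)"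

end

theory Submission
  imports Defs "HOL-Real_Asymp.Real_Asymp"
begin

text \<open>
  Write \<open>\<lambda> = lambda0 re\<close>, so \<open>\<lambda> \<rightarrow> 0\<close> as \<open>re \<rightarrow> \<infinity>\<close>, and \<open>R\<close> for the well block radius. The
  transcendental equation is linear in \<open>sin (\<lambda> * R)\<close>, hence determines \<open>sin (\<lambda> * R) / \<lambda>\<close> as a
  function of \<open>\<lambda>\<close> alone (\<open>bd_well_block_radius_solve_sin\<close>): a numerator
  \<open>sin (\<lambda> * \<Delta>) / \<lambda> - \<Delta> / 2\<close>, which tends to \<open>\<Delta> - \<Delta> / 2\<close>, over a denominator that tends to \<open>1\<close>.

  It remains to replace \<open>sin (\<lambda> * R) / \<lambda>\<close> by \<open>R\<close>, although \<open>R\<close> may depend on \<open>re\<close> in any way.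
  Since \<open>x - sin x\<close> is increasing and \<open>0 < R < \<Delta>\<close>, the error \<open>R - sin (\<lambda> * R) / \<lambda>\<close> lies between
  \<open>0\<close> and \<open>\<Delta> - sin (\<lambda> * \<Delta>) / \<lambda>\<close>, which tends to \<open>0\<close> (\<open>minus_scaled_sin_bounds\<close>).
\<close>

lemma mono_minus_sin:
  fixes a b :: real
  assumes "a \<le> b"
  shows "a - sin a \<le> b - sin b"
proof (rule DERIV_nonneg_imp_nondecreasing [OF assms])
  fix x :: real
  have "((\<lambda>x. x - sin x) has_real_derivative 1 - cos x) (at x)"
    by (auto intro!: derivative_eq_intros)
  then show "\<exists>y. ((\<lambda>x. x - sin x) has_real_derivative y) (at x) \<and> 0 \<le> y"
    by (intro exI[of _ "1 - cos x"]) simp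
qed

text \<open>
  The upper bound is free of \<open>R\<close>: linearising the sine at \<open>l = 0\<close> costs an error that is uniform
  over \<open>{0..\<Delta>}\<close>, worst at the endpoint \<open>\<Delta>\<close>.
\<close>

lemma minus_scaled_sin_bounds:
  fixes l R \<Delta> :: real
  assumes "l > 0" "0 \<le> R" "R \<le> \<Delta>"
  shows "0 \<le> R - sin (l * R) / l" and "R - sin (l * R) / l \<le> \<Delta> - sin (l * \<Delta>) / l"
proof -
  have "0 - sin 0 \<le> l * R - sin (l * R)" "l * R - sin (l * R) \<le> l * \<Delta> - sin (l * \<Delta>)"
    using assms by (intro mono_minus_sin mult_left_mono; simp)+
  then have "(0 - sin 0) / l \<le> (l * R - sin (l * R)) / l"
    "(l * R - sin (l * R)) / l \<le> (l * \<Delta> - sin (l * \<Delta>)) / l"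
    using assms(1) by (intro divide_right_mono; simp)+
  then show "0 \<le> R - sin (l * R) / l" "R - sin (l * R) / l \<le> \<Delta> - sin (l * \<Delta>) / l"
    using assms(1) by (simp_all add: diff_divide_distrib)
qed

text \<open>
  The exponential term moves to the left with a positive sign, so that the coefficient of
  \<open>sin (lambda0 re * R)\<close> is at least \<open>1\<close> and can be divided out.
\<close>

lemma bd_well_block_radius_solve_sin:
  assumes "K > 0" "\<tau> > 0" "re > 0" and R: "bd_well_block_radius K \<tau> \<Delta> re R"
  shows "sin (lambda0 re * R) / lambda0 re =
    (sin (lambda0 re * \<Delta>) / lambda0 re - \<Delta> / 2) /
    (1 + (1 - exp (- (lambda0 re)\<^sup>2 * \<tau>)) / (2 * K * \<tau>))"
proof -
  define l where "l = lambda0 re"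
  define D where "D = 1 + (1 - exp (- l\<^sup>2 * \<tau>)) / (2 * K * \<tau>)"
  have l: "l > 0"
    using assms by (simp add: l_def lambda0_def)
  have "exp (- l\<^sup>2 * \<tau>) \<le> 1"
    using assms by simp
  then have D: "D > 0"
    using assms unfolding D_def by (intro add_pos_nonneg divide_nonneg_pos) auto
  have "D = 1 - 1 / (2 * K) * ((exp (- l\<^sup>2 * \<tau>) - 1) / \<tau>)"
    by (simp add: D_def diff_divide_distrib mult_ac)
  then have "sin (l * R) * D =
      sin (l * R) - sin (l * R) * (1 / (2 * K)) * ((exp (- l\<^sup>2 * \<tau>) - 1) / \<tau>)"
    by (simp only: right_diff_distrib mult_1_right mult.assoc)
  also have "\<dots> = sin (l * \<Delta>) - l * \<Delta> / 2"
    using R unfolding bd_well_block_radius_def l_def by linarith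
  finally have "sin (l * R) = (sin (l * \<Delta>) - l * \<Delta> / 2) / D"
    using D by (simp add: eq_divide_eq)
  then have "sin (l * R) / l = (sin (l * \<Delta>) / l - \<Delta> / 2) / D"
    using l by (simp add: diff_divide_distrib)
  then show ?thesis
    by (simp add: D_def l_def)
qed

theorem theorem4:
  fixes K \<Delta> \<tau> :: real and R0bd :: "real \<Rightarrow> real"
  assumes "K > 0" and "\<Delta> > 0" and "\<tau> > 0"
    and "\<And>re. re > \<Delta> \<Longrightarrow> bd_well_block_radius K \<tau> \<Delta> re (R0bd re)"
  shows "(R0bd \<longlongrightarrow> \<Delta> / 2) at_top"
proof -
  let ?l = lambda0
  have large: "eventually (\<lambda>re. re > \<Delta>) at_top"
    by (rule eventually_gt_at_top)
  have main: "((\<lambda>re. sin (?l re * R0bd re) / ?l re) \<longlongrightarrow> \<Delta> / 2) at_top"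
  proof (rule Lim_transform_eventually)
    show "((\<lambda>re. (sin (?l re * \<Delta>) / ?l re - \<Delta> / 2) /
        (1 + (1 - exp (- (?l re)\<^sup>2 * \<tau>)) / (2 * K * \<tau>))) \<longlongrightarrow> \<Delta> / 2) at_top"
      unfolding lambda0_def using assms(1-3) by real_asymp
    show "eventually (\<lambda>re. (sin (?l re * \<Delta>) / ?l re - \<Delta> / 2) /
        (1 + (1 - exp (- (?l re)\<^sup>2 * \<tau>)) / (2 * K * \<tau>)) = sin (?l re * R0bd re) / ?l re) at_top"
      using large
    proof eventually_elim
      case (elim re)
      then show ?case
        using assms(2) by (intro bd_well_block_radius_solve_sin[symmetric] assms) simp
    qed
  qed
  have error: "((\<lambda>re. R0bd re - sin (?l re * R0bd re) / ?l re) \<longlongrightarrow> 0) at_top"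
  proof (rule tendsto_sandwich)
    have bounds: "0 \<le> R0bd re - sin (?l re * R0bd re) / ?l re"
      "R0bd re - sin (?l re * R0bd re) / ?l re \<le> \<Delta> - sin (?l re * \<Delta>) / ?l re"
      if "re > \<Delta>" for re
    proof -
      have "?l re > 0" "0 \<le> R0bd re" "R0bd re \<le> \<Delta>"
        using that assms(2) assms(4)[OF that]
        by (simp_all add: lambda0_def bd_well_block_radius_def)
      then show "0 \<le> R0bd re - sin (?l re * R0bd re) / ?l re"
        "R0bd re - sin (?l re * R0bd re) / ?l re \<le> \<Delta> - sin (?l re * \<Delta>) / ?l re"
        by (rule minus_scaled_sin_bounds)+
    qed
    show "eventually (\<lambda>re. 0 \<le> R0bd re - sin (?l re * R0bd re) / ?l re) at_top"
      using large by eventually_elim (rule bounds)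
    show "eventually (\<lambda>re. R0bd re - sin (?l re * R0bd re) / ?l re
        \<le> \<Delta> - sin (?l re * \<Delta>) / ?l re) at_top"
      using large by eventually_elim (rule bounds)
    show "((\<lambda>re. \<Delta> - sin (?l re * \<Delta>) / ?l re) \<longlongrightarrow> 0) at_top"
      unfolding lambda0_def using assms(2) by real_asymp
  qed simp
  show ?thesis
    using tendsto_add[OF main error] by simp
qed

end
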